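(* Let $(X,\mathcal{B})$ be a ball space and let $f:X\to X$ be a function which is ultimately contracting on orbits, witnessed by the function $X\ni x\mapsto B_x\in\mathcal{B}$. Assume that for every $f$-nest $\mathcal{N}$ in this ball space there is some $z\in\bigcap\mathcal{N}$ such that $B_z\subseteq\bigcap\mathcal{N}$. Then for every $x\in X$, $f$ has a fixed point in $B_x$.
   Context: A ball space $(X,\mathcal{B})$ consists of a nonempty set $X$ and a nonempty family $\mathcal{B}$ of nonempty subsets of $X$, called balls. A nest of balls is a nonempty subset of $\mathcal{B}$ which is totally ordered by inclusion. We write $fx$ for $f(x)$, and $f^i$ is the $i$-th iterate of $f$ ($f^0x=x$, $f^{i+1}x=f(f^ix)$). The function $f$ is ultimately contracting on orbits if there is a function $X\ni x\mapsto B_x\in\mathcal{B}$ such that for all $x\in X$: (NB) $x\in B_x$; (CO) $B_{fx}\subseteq B_x$, and if $x\neq fx$, then $B_{f^ix}\subsetneq B_x$ for some $i\geq 1$. A nest $\mathcal{N}$ of balls is called an $f$-nest (with respect to this function $x\mapsto B_x$) if $\mathcal{N}=\{B_x\mid x\in S\}$ for some set $S\subseteq X$ that is closed under $f$. *)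

theory Defs
  imports Main "HOL-Library.FuncSet"
begin

text \<open>
  The underlying set of a ball space is an explicit carrier \<open>X\<close>; self-maps of \<open>X\<close> and
  assignments of balls to points are total HOL functions of which only the values on \<open>X\<close> matter.
\<close>

definition ball_space :: "'a set \<Rightarrow> 'a set set \<Rightarrow> bool" where
  "ball_space X \<B> \<longleftrightarrow> X \<noteq> {} \<and> \<B> \<noteq> {} \<and> (\<forall>U\<in>\<B>. U \<noteq> {} \<and> U \<subseteq> X)"

definition nest_of_balls :: "'a set set \<Rightarrow> 'a set set \<Rightarrow> bool" where
  "nest_of_balls \<B> \<N> \<longleftrightarrow> \<N> \<noteq> {} \<and> \<N> \<subseteq> \<B> \<and> chain_subset \<N>"

text \<open>The assignment \<open>B\<close> witnesses that \<open>f\<close> is ultimately contracting on orbits;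
  the conjuncts after the typing of \<open>B\<close> are (NB) and (CO).\<close>

definition witnesses_ult_contracting ::
  "'a set \<Rightarrow> 'a set set \<Rightarrow> ('a \<Rightarrow> 'a) \<Rightarrow> ('a \<Rightarrow> 'a set) \<Rightarrow> bool" where
  "witnesses_ult_contracting X \<B> f B \<longleftrightarrow>
     B \<in> X \<rightarrow> \<B> \<and>
     (\<forall>x\<in>X. x \<in> B x \<and>
        B (f x) \<subseteq> B x \<and> (x \<noteq> f x \<longrightarrow> (\<exists>i\<ge>1. B ((f ^^ i) x) \<subset> B x)))"

definition f_nest ::
  "'a set \<Rightarrow> 'a set set \<Rightarrow> ('a \<Rightarrow> 'a) \<Rightarrow> ('a \<Rightarrow> 'a set) \<Rightarrow> 'a set set \<Rightarrow> bool" where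
  "f_nest X \<B> f B \<N> \<longleftrightarrow>
     nest_of_balls \<B> \<N> \<and> (\<exists>S\<subseteq>X. f ` S \<subseteq> S \<and> \<N> = {B x | x. x \<in> S})"

end

theory Submission
  imports Defs
begin

text \<open>
  By Zorn's lemma there is a maximal \<open>f\<close>-closed set \<open>S\<close> containing \<open>x\<close> whose balls form a nest.
  The hypothesis on \<open>f\<close>-nests gives a point \<open>z\<close> whose ball lies in every ball of this nest. The
  balls along the orbit of \<open>z\<close> decrease from \<open>B z\<close>, so they prolong the nest downwards, and by
  maximality the orbit of \<open>z\<close> already lies in \<open>S\<close>. Thus \<open>B z\<close> is contained in every ball of its
  own orbit, that is, the ball never shrinks strictly, and (CO) leaves only \<open>f z = z\<close>.
  Finally \<open>z \<in> B z \<subseteq> B x\<close>, as \<open>x \<in> S\<close>.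

  Zorn's lemma is applied to the index sets \<open>S\<close> rather than to the nests \<open>{B y | y \<in> S}\<close>:
  unions of chains of index sets are again \<open>f\<close>-closed, whereas a nest may be indexed by many
  different sets.
\<close>

definition f_nest_index :: "'a set \<Rightarrow> ('a \<Rightarrow> 'a) \<Rightarrow> ('a \<Rightarrow> 'a set) \<Rightarrow> 'a set \<Rightarrow> bool" where
  "f_nest_index X f B S \<longleftrightarrow> S \<subseteq> X \<and> f ` S \<subseteq> S \<and> chain_subset (B ` S)"

lemma funpow_closed:
  assumes "f ` S \<subseteq> S" "z \<in> S"
  shows "(f ^^ i) z \<in> S"
  using assms by (induction i) auto

lemma orbit_balls_antimono:
  assumes "f \<in> X \<rightarrow> X" "z \<in> X" and decr: "\<And>y. y \<in> X \<Longrightarrow> B (f y) \<subseteq> B y" and "i \<le> j"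
  shows "B ((f ^^ j) z) \<subseteq> B ((f ^^ i) z)"
proof (rule lift_Suc_antimono_le[OF _ \<open>i \<le> j\<close>])
  fix n
  have "(f ^^ n) z \<in> X"
    using assms by (intro funpow_closed) auto
  then show "B ((f ^^ Suc n) z) \<subseteq> B ((f ^^ n) z)"
    using decr by simp
qed

text \<open>The balls along the orbit decrease, and each of them lies below all balls indexed by
  \<open>S\<close>. With \<open>S = {}\<close> this says that an orbit by itself indexes a nest.\<close>

lemma f_nest_index_Un_orbit:
  assumes S: "f_nest_index X f B S"
    and f: "f \<in> X \<rightarrow> X" and z: "z \<in> X" and decr: "\<And>y. y \<in> X \<Longrightarrow> B (f y) \<subseteq> B y"
    and below: "\<And>y. y \<in> S \<Longrightarrow> B z \<subseteq> B y"
  shows "f_nest_index X f B (S \<union> range (\<lambda>i. (f ^^ i) z))"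
proof -
  let ?O = "range (\<lambda>i. (f ^^ i) z)"
  have "?O \<subseteq> X"
    using f z by (auto intro!: funpow_closed)
  moreover have "f ((f ^^ i) z) \<in> ?O" for i
    by (rule range_eqI[of _ _ "Suc i"]) simp
  then have "f ` ?O \<subseteq> ?O"
    by blast
  moreover have "chain_subset (B ` (S \<union> ?O))"
    unfolding chain_subset_def
  proof (intro ballI)
    have chain: "\<forall>U\<in>B ` S. \<forall>V\<in>B ` S. U \<subseteq> V \<or> V \<subseteq> U"
      using S unfolding f_nest_index_def chain_subset_def by (elim conjE)
    have low: "B ((f ^^ i) z) \<subseteq> B y" if "y \<in> S" for i y
      using orbit_balls_antimono[of f X z B 0 i] f z decr below[OF that] by fastforce
    have orbit: "B ((f ^^ i) z) \<subseteq> B ((f ^^ j) z) \<or> B ((f ^^ j) z) \<subseteq> B ((f ^^ i) z)" for i j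
      using nat_le_linear[of i j] orbit_balls_antimono[of f X z B] f z decr by metis
    fix U V
    assume "U \<in> B ` (S \<union> ?O)" "V \<in> B ` (S \<union> ?O)"
    then consider "U \<in> B ` S" "V \<in> B ` S" | "U \<in> B ` S" "V \<in> B ` ?O"
      | "U \<in> B ` ?O" "V \<in> B ` S" | "U \<in> B ` ?O" "V \<in> B ` ?O"
      by blast
    then show "U \<subseteq> V \<or> V \<subseteq> U"
    proof cases
      case 1
      then show ?thesis
        by (rule chain[THEN bspec, THEN bspec])
    next
      case 2
      then show ?thesis
        using low by (elim imageE) simp
    next
      case 3
      then show ?thesis
        using low by (elim imageE) simp
    next
      case 4
      then show ?thesis
        using orbit by (elim imageE) simp
    qed
  qed
  ultimately show ?thesis
    using S by (simp add: f_nest_index_def image_Un le_supI1 le_supI2)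
qed

lemma f_nest_index_Union:
  assumes "subset.chain {S. f_nest_index X f B S} C"
  shows "f_nest_index X f B (\<Union>C)"
proof -
  have index: "f_nest_index X f B S" if "S \<in> C" for S
    using assms that by (auto simp: subset.chain_def)
  have "B u \<subseteq> B v \<or> B v \<subseteq> B u" if uv: "u \<in> \<Union>C" "v \<in> \<Union>C" for u v
  proof -
    obtain S T where "S \<in> C" "T \<in> C" "u \<in> S" "v \<in> T"
      using uv by blast
    moreover from this have "S \<subseteq> T \<or> T \<subseteq> S"
      using assms by (auto simp: subset_chain_def)
    ultimately obtain R where "R \<in> C" "u \<in> R" "v \<in> R"
      by blast
    then show ?thesis
      using index[of R] by (auto simp: f_nest_index_def chain_subset_def)
  qed
  then have "chain_subset (B ` \<Union>C)"
    by (auto simp: chain_subset_def)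
  moreover have "\<Union>C \<subseteq> X" "f ` \<Union>C \<subseteq> \<Union>C"
    using index unfolding f_nest_index_def by blast+
  ultimately show ?thesis
    by (simp add: f_nest_index_def)
qed

lemma maximal_f_nest_index:
  assumes S: "f_nest_index X f B S"
  obtains M where "f_nest_index X f B M" "S \<subseteq> M"
    "\<And>T. f_nest_index X f B T \<Longrightarrow> M \<subseteq> T \<Longrightarrow> T = M"
proof -
  let ?A = "{T. f_nest_index X f B T \<and> S \<subseteq> T}"
  have "\<exists>M\<in>?A. \<forall>T\<in>?A. M \<subseteq> T \<longrightarrow> T = M"
  proof (rule subset_Zorn_nonempty)
    show "?A \<noteq> {}"
      using S by blast
    fix C
    assume "C \<noteq> {}" and C: "subset.chain ?A C"
    from C have "subset.chain {T. f_nest_index X f B T} C"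
      by (auto simp: subset_chain_def)
    moreover have "S \<subseteq> \<Union>C"
      using \<open>C \<noteq> {}\<close> C unfolding subset_chain_def by blast
    ultimately show "\<Union>C \<in> ?A"
      by (simp add: f_nest_index_Union)
  qed
  then obtain M where M: "M \<in> ?A" and maximal: "\<forall>T\<in>?A. M \<subseteq> T \<longrightarrow> T = M"
    by (rule bexE)
  show ?thesis
  proof (rule that)
    show "f_nest_index X f B M" "S \<subseteq> M"
      using M by simp_all
    show "T = M" if "f_nest_index X f B T" "M \<subseteq> T" for T
      using that M maximal subset_trans[of S M T] by simp
  qed
qed

theorem theorem2p7:
  fixes X :: "'a set" and \<B> :: "'a set set"
    and f :: "'a \<Rightarrow> 'a" and B :: "'a \<Rightarrow> 'a set"
  assumes "ball_space X \<B>"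
    and "f \<in> X \<rightarrow> X"
    and "witnesses_ult_contracting X \<B> f B"
    and "\<And>\<N>. f_nest X \<B> f B \<N> \<Longrightarrow> \<exists>z\<in>\<Inter>\<N>. B z \<subseteq> \<Inter>\<N>"
  shows "\<forall>x\<in>X. \<exists>z\<in>B x. f z = z"
proof
  fix x
  assume x: "x \<in> X"
  have ball: "B y \<in> \<B>" and decr: "B (f y) \<subseteq> B y" if "y \<in> X" for y
    using assms(3) that by (auto simp: witnesses_ult_contracting_def)
  have contr: "\<exists>i\<ge>1. B ((f ^^ i) y) \<subset> B y" if "y \<in> X" "y \<noteq> f y" for y
    using assms(3) that by (simp add: witnesses_ult_contracting_def)
  have "f_nest_index X f B {}"
    by (simp add: f_nest_index_def chain_subset_def)
  then have "f_nest_index X f B ({} \<union> range (\<lambda>i. (f ^^ i) x))"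
    using assms(2) x decr by (intro f_nest_index_Un_orbit) auto
  then obtain S where S: "f_nest_index X f B S" "range (\<lambda>i. (f ^^ i) x) \<subseteq> S"
    and maximal: "\<And>T. f_nest_index X f B T \<Longrightarrow> S \<subseteq> T \<Longrightarrow> T = S"
    by (auto elim: maximal_f_nest_index)
  have "(f ^^ 0) x \<in> S"
    using S(2) by blast
  then have "x \<in> S"
    by simp
  have "f_nest X \<B> f B (B ` S)"
    using S(1) \<open>x \<in> S\<close> ball
    unfolding f_nest_def nest_of_balls_def f_nest_index_def by blast
  then obtain z where z: "z \<in> \<Inter>(B ` S)" and Bz: "B z \<subseteq> \<Inter>(B ` S)"
    using assms(4) by blast
  have "z \<in> B x"
    using z \<open>x \<in> S\<close> by blast
  then have "z \<in> X"
    using assms(1) ball[OF x] by (auto simp: ball_space_def)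
  have "f_nest_index X f B (S \<union> range (\<lambda>i. (f ^^ i) z))"
    using S(1) assms(2) \<open>z \<in> X\<close> decr Bz by (intro f_nest_index_Un_orbit) auto
  then have orbit: "(f ^^ i) z \<in> S" for i
    using maximal by blast
  have "B z \<subseteq> B ((f ^^ i) z)" for i
    using Bz orbit by blast
  then have "f z = z"
    using contr[OF \<open>z \<in> X\<close>] by fastforce
  with \<open>z \<in> B x\<close> show "\<exists>z\<in>B x. f z = z"
    by blast
qed

end
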